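(* Let $d,n\ge 1$ be integers and let $C^d_n=\{1,\dots,n\}^d$. For every point $c=(X_1,\dots,X_d)\in C^d_n$: (1) if the coordinates of $c$ are listed in non-increasing order of value, with $X_h$ placed before $X_k$ whenever $X_h=X_k$ and $h<k$, then $c$ satisfies the Euler fishbone associated with the resulting permutation of the variables; (2) $c$ satisfies only one Euler fishbone. Consequently the $d!$ Euler fishbones (the Euler Escher) determine a partition of $C^d_n$: every point of $C^d_n$ belongs to the solution set of exactly one of them.
   Context: For a permutation $(h_1,\dots,h_d)$ of $(1,\dots,d)$, the associated Euler fishbone is the chain of inequalities $X_{h_1}\,R_1\,X_{h_2}\,R_2\cdots R_{d-1}\,X_{h_d}$ where $R_i$ is the sign $\ge$ if $h_{i+1}>h_i$ and the sign $>$ if $h_{i+1}<h_i$. The Euler Escher is the set of the $d!$ Euler fishbones obtained from all permutations of $(1,\dots,d)$. *)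

theory Defs
  imports
    "HOL-Combinatorics.Multiset_Permutations"
    "HOL-Library.FuncSet"
    "HOL-Library.Disjoint_Sets"
begin

text \<open>
  A permutation of \<open>(1, \<dots>, d)\<close> is the list \<open>[h\<^sub>1, \<dots>, h\<^sub>d]\<close>, an element of
  \<open>permutations_of_set {1..d}\<close>.  List positions start at \<open>0\<close>, so \<open>hs ! i\<close> is \<open>h\<^sub>i\<^sub>+\<^sub>1\<close>.
\<close>

definition cube :: "nat \<Rightarrow> nat \<Rightarrow> (nat \<Rightarrow> nat) set" where
  "cube d n = {1..d} \<rightarrow>\<^sub>E {1..n}"

datatype sign = Geq | Gt

fun sign_rel :: "sign \<Rightarrow> nat \<Rightarrow> nat \<Rightarrow> bool" where
  "sign_rel Geq x y \<longleftrightarrow> x \<ge> y"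
| "sign_rel Gt x y \<longleftrightarrow> x > y"

text \<open>
  The pair \<open>([h\<^sub>1, \<dots>, h\<^sub>d], [R\<^sub>1, \<dots>, R\<^sub>d\<^sub>-\<^sub>1])\<close> encodes the formal chain
  \<open>X\<^bsub>h\<^sub>1\<^esub> R\<^sub>1 X\<^bsub>h\<^sub>2\<^esub> R\<^sub>2 \<dots> R\<^sub>d\<^sub>-\<^sub>1 X\<^bsub>h\<^sub>d\<^esub>\<close>.
  Chains are kept apart from their solution sets, since two different fishbones may both have an
  empty solution set in the cube.
\<close>

type_synonym chain = "nat list \<times> sign list"

definition satisfies :: "(nat \<Rightarrow> nat) \<Rightarrow> chain \<Rightarrow> bool" where
  "satisfies c F \<longleftrightarrow>
     (\<forall>i. i + 1 < length (fst F) \<longrightarrow>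
        sign_rel (snd F ! i) (c (fst F ! i)) (c (fst F ! (i + 1))))"

definition euler_fishbone :: "nat list \<Rightarrow> chain" where
  "euler_fishbone hs =
     (hs, map (\<lambda>i. if hs ! (i + 1) > hs ! i then Geq else Gt) [0..<length hs - 1])"

definition euler_escher :: "nat \<Rightarrow> chain set" where
  "euler_escher d = euler_fishbone ` permutations_of_set {1..d}"

definition solution_set :: "nat \<Rightarrow> nat \<Rightarrow> chain \<Rightarrow> (nat \<Rightarrow> nat) set" where
  "solution_set d n F = {c \<in> cube d n. satisfies c F}"

definition nonincreasing_listing :: "nat \<Rightarrow> (nat \<Rightarrow> nat) \<Rightarrow> nat list \<Rightarrow> bool" where
  "nonincreasing_listing d c hs \<longleftrightarrow>
     hs \<in> permutations_of_set {1..d} \<and>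
     sorted_wrt (\<lambda>h k. c h \<ge> c k) hs \<and>
     (\<forall>i < length hs. \<forall>j < length hs.
        c (hs ! i) = c (hs ! j) \<and> hs ! i < hs ! j \<longrightarrow> i < j)"

end

theory Submission
  imports Defs
begin

text \<open>
  Fix a point \<open>c\<close> and order the indices by decreasing value of \<open>c\<close>, breaking ties by
  increasing index.  This is a strict \<^emph>\<open>linear\<close> order on the indices, and both notions
  occurring in the theorem describe lists increasing for it.  For the non-increasing listing this
  is immediate; for an Euler fishbone it holds because its sign is non-strict exactly when the
  next index is larger, so that a single link of the fishbone says that the two neighbouring
  indices are in the right order (\<open>euler_sign_iff_precedes\<close>), and by transitivity it suffices to
  compare neighbours (\<open>satisfies_euler_fishbone_iff\<close>).  A finite set has exactly one increasing
  enumeration with respect to a linear order, so each point satisfies the fishbone of exactly one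
  permutation (\<open>ex1_precedes_sorted\<close>).  The partition of the cube is a restatement of this.
\<close>

definition precedes :: "(nat \<Rightarrow> nat) \<Rightarrow> nat \<Rightarrow> nat \<Rightarrow> bool" where
  "precedes c h k \<longleftrightarrow> c h > c k \<or> c h = c k \<and> h < k"

lemma linorder_precedes: "class.linorder (\<lambda>h k. precedes c h k \<or> h = k) (precedes c)"
  by unfold_locales (auto simp: precedes_def)

lemma transp_precedes: "transp (precedes c)"
  by (auto simp: transp_def precedes_def)

text \<open>
  A list is increasing for the strict order iff it is distinct and increasing for the non-strict
  one, so this is the uniqueness of the sorted distinct enumeration of a finite set, applied to
  the order that depends on \<open>c\<close>.
\<close>

lemma ex1_precedes_sorted:
  assumes "finite A"
  shows "\<exists>!hs. hs \<in> permutations_of_set A \<and> sorted_wrt (precedes c) hs"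
proof -
  interpret prec: linorder "\<lambda>h k. precedes c h k \<or> h = k" "precedes c"
    by (rule linorder_precedes)
  have "hs \<in> permutations_of_set A \<and> sorted_wrt (precedes c) hs
      \<longleftrightarrow> set hs = A \<and> sorted_wrt (\<lambda>h k. precedes c h k \<or> h = k) hs \<and> distinct hs" for hs
    by (auto simp: permutations_of_set_def prec.strict_sorted_iff)
  with prec.finite_sorted_distinct_unique[OF assms] show ?thesis
    by simp
qed

text \<open>
  When the next index is smaller, a tie in value would put the two indices in the wrong order,
  which is why the sign must then be strict.
\<close>

lemma euler_sign_iff_precedes:
  assumes "h \<noteq> k"
  shows "sign_rel (if k > h then Geq else Gt) (c h) (c k) \<longleftrightarrow> precedes c h k"
  using assms by (auto simp: precedes_def)

lemma satisfies_euler_fishbone_iff: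
  assumes "distinct hs"
  shows "satisfies c (euler_fishbone hs) \<longleftrightarrow> sorted_wrt (precedes c) hs"
proof -
  have "sign_rel (snd (euler_fishbone hs) ! i) (c (hs ! i)) (c (hs ! (i + 1)))
      \<longleftrightarrow> precedes c (hs ! i) (hs ! (i + 1))" if "i + 1 < length hs" for i
  proof -
    have neq: "hs ! i \<noteq> hs ! (i + 1)"
      using assms that by (simp add: nth_eq_iff_index_eq)
    have sign: "snd (euler_fishbone hs) ! i = (if hs ! (i + 1) > hs ! i then Geq else Gt)"
      using that by (simp add: euler_fishbone_def)
    show ?thesis
      unfolding sign using neq by (rule euler_sign_iff_precedes)
  qed
  then show ?thesis
    by (simp add: satisfies_def euler_fishbone_def
        sorted_wrt_iff_nth_Suc_transp[OF transp_precedes])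
qed

lemma nonincreasing_listing_iff:
  "nonincreasing_listing d c hs
     \<longleftrightarrow> hs \<in> permutations_of_set {1..d} \<and> sorted_wrt (precedes c) hs"
proof (cases "distinct hs")
  case True
  have "sorted_wrt (\<lambda>h k. c h \<ge> c k) hs \<and>
      (\<forall>i < length hs. \<forall>j < length hs. c (hs ! i) = c (hs ! j) \<and> hs ! i < hs ! j \<longrightarrow> i < j)
    \<longleftrightarrow> sorted_wrt (precedes c) hs" (is "?L \<longleftrightarrow> ?R")
  proof
    assume L: ?L
    have "precedes c (hs ! i) (hs ! j)" if "i < j" "j < length hs" for i j
    proof -
      have "c (hs ! i) \<ge> c (hs ! j)" "hs ! i \<noteq> hs ! j"
        using L that True by (auto simp: sorted_wrt_iff_nth_less nth_eq_iff_index_eq)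
      moreover have "\<not> (c (hs ! j) = c (hs ! i) \<and> hs ! j < hs ! i)"
        using L that by (meson less_asym' less_trans)
      ultimately show ?thesis
        by (auto simp: precedes_def)
    qed
    then show ?R
      by (simp add: sorted_wrt_iff_nth_less)
  next
    assume R: ?R
    have "i < j" if "i < length hs" "c (hs ! i) = c (hs ! j)" "hs ! i < hs ! j" for i j
    proof (rule ccontr)
      assume "\<not> i < j"
      with that(3) have "j < i"
        by (cases i j rule: linorder_cases) auto
      with R that(1) have "precedes c (hs ! j) (hs ! i)"
        by (simp add: sorted_wrt_iff_nth_less)
      with that(2,3) show False
        by (simp add: precedes_def)
    qed
    moreover have "sorted_wrt (\<lambda>h k. c h \<ge> c k) hs"
      using R by (rule sorted_wrt_mono_rel[rotated]) (auto simp: precedes_def)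
    ultimately show ?L
      by blast
  qed
  then show ?thesis
    by (simp add: nonincreasing_listing_def)
next
  case False
  then show ?thesis
    by (simp add: nonincreasing_listing_def permutations_of_set_def)
qed

lemma inj_euler_fishbone: "inj euler_fishbone"
  by (rule injI) (simp add: euler_fishbone_def)

lemma card_euler_escher: "card (euler_escher d) = fact d"
  by (simp add: euler_escher_def card_image inj_on_subset[OF inj_euler_fishbone])

lemma ex1_euler_fishbone: "\<exists>!F. F \<in> euler_escher d \<and> satisfies c F"
proof -
  have "\<exists>!hs. hs \<in> permutations_of_set {1..d} \<and> satisfies c (euler_fishbone hs)"
    using ex1_precedes_sorted[of "{1..d}" c]
    by (simp add: satisfies_euler_fishbone_iff permutations_of_setD cong: conj_cong)
  then show ?thesis
    unfolding euler_escher_def by blast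
qed

text \<open>
  The empty set has to be removed from the blocks: an Euler fishbone with at least \<open>n\<close> strict
  signs forces more than \<open>n\<close> distinct values and so has no solution in the cube.
\<close>

lemma partition_on_image_of_disjoint_family:
  assumes "disjoint_family_on S I"
  shows "partition_on (\<Union>i\<in>I. S i) (S ` I - {{}})"
proof (rule partition_onI)
  show "disjnt p q" if "p \<in> S ` I - {{}}" "q \<in> S ` I - {{}}" "p \<noteq> q" for p q
    using assms that by (fastforce simp: disjoint_family_on_def disjnt_def)
qed auto

theorem mainTheorem3:
  fixes d n :: nat
  assumes "d \<ge> 1" and "n \<ge> 1"
  shows "(\<forall>c \<in> cube d n.
            (\<exists>!hs. nonincreasing_listing d c hs) \<and>
            (\<forall>hs. nonincreasing_listing d c hs \<longrightarrow> satisfies c (euler_fishbone hs)))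
       \<and> (\<forall>c \<in> cube d n. \<forall>F \<in> euler_escher d. \<forall>G \<in> euler_escher d.
            satisfies c F \<and> satisfies c G \<longrightarrow> F = G)
       \<and> card (euler_escher d) = fact d
       \<and> (\<forall>c \<in> cube d n. \<exists>!F. F \<in> euler_escher d \<and> c \<in> solution_set d n F)
       \<and> disjoint_family_on (solution_set d n) (euler_escher d)
       \<and> (\<Union>F \<in> euler_escher d. solution_set d n F) = cube d n
       \<and> partition_on (cube d n) (solution_set d n ` euler_escher d - {{}})"
proof (intro conjI)
  show "\<forall>c \<in> cube d n. (\<exists>!hs. nonincreasing_listing d c hs) \<and>
      (\<forall>hs. nonincreasing_listing d c hs \<longrightarrow> satisfies c (euler_fishbone hs))"
    using ex1_precedes_sorted[of "{1..d}"]
    by (auto simp: nonincreasing_listing_iff satisfies_euler_fishbone_iff dest: permutations_of_setD)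
  show "\<forall>c \<in> cube d n. \<forall>F \<in> euler_escher d. \<forall>G \<in> euler_escher d.
      satisfies c F \<and> satisfies c G \<longrightarrow> F = G"
    using ex1_euler_fishbone by blast
  show "card (euler_escher d) = fact d"
    by (rule card_euler_escher)
  show "\<forall>c \<in> cube d n. \<exists>!F. F \<in> euler_escher d \<and> c \<in> solution_set d n F"
    using ex1_euler_fishbone by (simp add: solution_set_def)
  show disj: "disjoint_family_on (solution_set d n) (euler_escher d)"
    using ex1_euler_fishbone unfolding disjoint_family_on_def solution_set_def by blast
  show cover: "(\<Union>F \<in> euler_escher d. solution_set d n F) = cube d n"
    using ex1_euler_fishbone unfolding solution_set_def by blast
  show "partition_on (cube d n) (solution_set d n ` euler_escher d - {{}})"
    using partition_on_image_of_disjoint_family[OF disj] by (simp only: cover)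
qed

end
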